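(* Let $I$ be an index set, $a^1,\dots,a^n,b\in\mathbb{R}^I$, $c\in\mathbb{R}^n$, $U=\mathrm{span}(a^1,\dots,a^n,b)$, and consider the program of minimizing $\sum_{k=1}^n c_kx_k$ over $x\in\mathbb{R}^n$ subject to $\sum_{k=1}^n a^k(i)x_k\ge b(i)$ for all $i\in I$ (the primal). Let $Y$ be a linear subspace of $\mathbb{R}^I$ that contains $U$ as a subspace. Then: 1. if the pair (primal, $\mathrm{DSILP}(Y)$) satisfies (SD), then (SD) holds for every pair (primal, $\mathrm{DSILP}(Q)$) where $Q$ is a linear subspace of $Y$ that contains $U$; 2. if the pair (primal, $\mathrm{DSILP}(Y)$) satisfies (DP), then (DP) holds for every pair (primal, $\mathrm{DSILP}(Q)$) where $Q$ is a linear subspace of $Y$ that contains $U$.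
   Context: For $y\in\mathbb{R}^I$ let $OV(y)=\inf\{\sum_k c_kx_k : x\in\mathbb{R}^n,\ \sum_k a^k(i)x_k\ge y(i)\ \forall i\in I\}\in[-\infty,+\infty]$; "feasible for right-hand side $y$" means the set of such $x$ is nonempty. For a linear subspace $Y\subseteq\mathbb{R}^I$ containing $U$, let $Y'_+$ be the set of real linear functionals $\psi$ on $Y$ with $\psi(y)\ge0$ for every $y\in Y$ with $y(i)\ge0$ for all $i\in I$. $\mathrm{DSILP}(Y)$ is the problem: maximize $\psi(b)$ over $\psi\in Y'_+$ with $\psi(a^k)=c_k$ for $k=1,\dots,n$. (SD) for (primal, $\mathrm{DSILP}(Y)$): there exists $\psi^*\in Y'_+$ with $\psi^*(a^k)=c_k$ for $k=1,\dots,n$ and $\psi^*(b)=OV(b)$. (DP) for (primal, $\mathrm{DSILP}(Y)$): for every $d\in Y$ such that the primal is feasible for right-hand side $b+d$, there exist an optimal solution $\psi^*$ of $\mathrm{DSILP}(Y)$ and $\hat\epsilon>0$ such that $OV(b+\epsilon d)=\psi^*(b+\epsilon d)=OV(b)+\epsilon\psi^*(d)$ for all $\epsilon\in[0,\hat\epsilon]$. *)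

theory Defs
  imports
    Complex_Main
    "HOL-Library.Function_Algebras"
    "HOL-Library.FuncSet"
    "HOL-Library.Extended_Real"
begin

instantiation "fun" :: (type, real_vector) real_vector
begin

definition scaleR_fun :: "real \<Rightarrow> ('a \<Rightarrow> 'b) \<Rightarrow> 'a \<Rightarrow> 'b" where
  "scaleR_fun r f = (\<lambda>x. r *\<^sub>R f x)"

instance
  by standard (simp_all add: scaleR_fun_def fun_eq_iff scaleR_add_right scaleR_add_left)

end

text \<open>
  The index set \<open>I\<close> is an arbitrary (possibly empty) set. The space $\mathbb{R}^I$ is the
  space of functions that vanish outside \<open>I\<close>, which makes it a linear subspace of
  \<open>'i \<Rightarrow> real\<close>.

  The number \<open>n\<close> of variables is an arbitrary natural number. The coordinates of a point of
  $\mathbb{R}^n$ are indexed by \<open>{1..n}\<close>, and values outside this range never matter; likewise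
  for \<open>c\<close> and for the family \<open>a\<close>, where \<open>a k i\<close> stands for $a^k(i)$.
\<close>

definition real_functions :: "'i set \<Rightarrow> ('i \<Rightarrow> real) set" where
  "real_functions I = {y. \<forall>i. i \<notin> I \<longrightarrow> y i = 0}"

definition primal_feasible_set ::
    "'i set \<Rightarrow> nat \<Rightarrow> (nat \<Rightarrow> 'i \<Rightarrow> real) \<Rightarrow> ('i \<Rightarrow> real) \<Rightarrow> (nat \<Rightarrow> real) set" where
  "primal_feasible_set I n a y = {x. \<forall>i\<in>I. (\<Sum>k=1..n. a k i * x k) \<ge> y i}"

definition OV ::
    "'i set \<Rightarrow> nat \<Rightarrow> (nat \<Rightarrow> 'i \<Rightarrow> real) \<Rightarrow> (nat \<Rightarrow> real) \<Rightarrow> ('i \<Rightarrow> real) \<Rightarrow> ereal" where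
  "OV I n a c y = (INF x\<in>primal_feasible_set I n a y. ereal (\<Sum>k=1..n. c k * x k))"

definition constraint_space ::
    "nat \<Rightarrow> (nat \<Rightarrow> 'i \<Rightarrow> real) \<Rightarrow> ('i \<Rightarrow> real) \<Rightarrow> ('i \<Rightarrow> real) set" where
  "constraint_space n a b = span (insert b (a ` {1..n}))"

text \<open>
  Linear functionals on a subspace \<open>Y\<close> are functions with domain \<open>Y\<close>, i.e. they are
  \<open>undefined\<close> outside \<open>Y\<close>.
\<close>

definition linear_functionals :: "('i \<Rightarrow> real) set \<Rightarrow> (('i \<Rightarrow> real) \<Rightarrow> real) set" where
  "linear_functionals Y = {\<psi> \<in> extensional Y.
     (\<forall>y\<in>Y. \<forall>z\<in>Y. \<psi> (y + z) = \<psi> y + \<psi> z) \<and> (\<forall>r. \<forall>y\<in>Y. \<psi> (r *\<^sub>R y) = r * \<psi> y)}"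

definition positive_dual :: "'i set \<Rightarrow> ('i \<Rightarrow> real) set \<Rightarrow> (('i \<Rightarrow> real) \<Rightarrow> real) set" where
  "positive_dual I Y =
     {\<psi> \<in> linear_functionals Y. \<forall>y\<in>Y. (\<forall>i\<in>I. y i \<ge> 0) \<longrightarrow> \<psi> y \<ge> 0}"

definition DSILP_feasible_set ::
    "'i set \<Rightarrow> nat \<Rightarrow> (nat \<Rightarrow> 'i \<Rightarrow> real) \<Rightarrow> (nat \<Rightarrow> real) \<Rightarrow> ('i \<Rightarrow> real) set
      \<Rightarrow> (('i \<Rightarrow> real) \<Rightarrow> real) set" where
  "DSILP_feasible_set I n a c Y = {\<psi> \<in> positive_dual I Y. \<forall>k\<in>{1..n}. \<psi> (a k) = c k}"

definition DSILP_optimal ::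
    "'i set \<Rightarrow> nat \<Rightarrow> (nat \<Rightarrow> 'i \<Rightarrow> real) \<Rightarrow> (nat \<Rightarrow> real) \<Rightarrow> ('i \<Rightarrow> real) \<Rightarrow> ('i \<Rightarrow> real) set
      \<Rightarrow> (('i \<Rightarrow> real) \<Rightarrow> real) \<Rightarrow> bool" where
  "DSILP_optimal I n a c b Y \<psi> \<longleftrightarrow>
     \<psi> \<in> DSILP_feasible_set I n a c Y \<and> (\<forall>\<phi>\<in>DSILP_feasible_set I n a c Y. \<phi> b \<le> \<psi> b)"

definition SD ::
    "'i set \<Rightarrow> nat \<Rightarrow> (nat \<Rightarrow> 'i \<Rightarrow> real) \<Rightarrow> (nat \<Rightarrow> real) \<Rightarrow> ('i \<Rightarrow> real) \<Rightarrow> ('i \<Rightarrow> real) set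
      \<Rightarrow> bool" where
  "SD I n a c b Y \<longleftrightarrow> (\<exists>\<psi>\<in>DSILP_feasible_set I n a c Y. ereal (\<psi> b) = OV I n a c b)"

definition DP ::
    "'i set \<Rightarrow> nat \<Rightarrow> (nat \<Rightarrow> 'i \<Rightarrow> real) \<Rightarrow> (nat \<Rightarrow> real) \<Rightarrow> ('i \<Rightarrow> real) \<Rightarrow> ('i \<Rightarrow> real) set
      \<Rightarrow> bool" where
  "DP I n a c b Y \<longleftrightarrow>
     (\<forall>d\<in>Y. primal_feasible_set I n a (b + d) \<noteq> {} \<longrightarrow>
       (\<exists>\<psi> \<epsilon>'. DSILP_optimal I n a c b Y \<psi> \<and> \<epsilon>' > 0 \<and>
         (\<forall>\<epsilon>\<in>{0..\<epsilon>'}.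
            OV I n a c (b + \<epsilon> *\<^sub>R d) = ereal (\<psi> (b + \<epsilon> *\<^sub>R d)) \<and>
            ereal (\<psi> (b + \<epsilon> *\<^sub>R d)) = OV I n a c b + ereal (\<epsilon> * \<psi> d))))"

end

theory Submission
  imports Defs
begin

text \<open>
  Both properties pass from \<open>Y\<close> to a smaller space \<open>Q\<close> by restricting the functionals that witness
  them. Feasibility and all values at points of \<open>Q\<close> survive the restriction, and \<open>Q\<close> contains the
  points \<open>a k\<close>, \<open>b\<close> and \<open>b + \<epsilon> d\<close> at which (SD) and (DP) evaluate the functional. This settles (SD).

  For (DP) it must also be shown that the restriction of an optimal solution stays optimal, which is
  not automatic: the smaller space has more functionals, because not every positive functional on
  \<open>Q\<close> need extend to \<open>Y\<close>. Weak duality on \<open>Q\<close> excludes a larger value. It bounds every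
  feasible functional on \<open>Q\<close> by \<open>OV b\<close> at \<open>b\<close>, and (DP) at \<open>\<epsilon> = 0\<close> says that the given functional
  attains this bound.
\<close>

lemma constraint_space_mem:
  shows rhs_in_constraint_space: "b \<in> constraint_space n a b"
    and column_in_constraint_space: "k \<in> {1..n} \<Longrightarrow> a k \<in> constraint_space n a b"
  unfolding constraint_space_def by (rule span_base; blast)+

lemma linear_functionals_sum:
  assumes "subspace Q" "\<phi> \<in> linear_functionals Q" "finite S" "\<And>k. k \<in> S \<Longrightarrow> f k \<in> Q"
  shows "\<phi> (\<Sum>k\<in>S. r k *\<^sub>R f k) = (\<Sum>k\<in>S. r k * \<phi> (f k))"
  using assms(3,4)
proof (induction S rule: finite_induct)
  case empty
  have "\<phi> (0 *\<^sub>R 0) = 0 * \<phi> 0"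
    using assms(1,2) subspace_0 unfolding linear_functionals_def by blast
  then show ?case by (simp add: zero_fun_def)
next
  case (insert k S)
  have "r k *\<^sub>R f k \<in> Q" "(\<Sum>k\<in>S. r k *\<^sub>R f k) \<in> Q"
    using insert.prems assms(1) by (auto intro: subspace_scale subspace_sum)
  then have "\<phi> (r k *\<^sub>R f k + (\<Sum>k\<in>S. r k *\<^sub>R f k)) =
      r k * \<phi> (f k) + \<phi> (\<Sum>k\<in>S. r k *\<^sub>R f k)"
    using assms(2) insert.prems unfolding linear_functionals_def by auto
  then show ?case
    using insert.hyps insert.IH[OF insert.prems]
    by (simp only: sum.insert[OF insert.hyps] insertI2)
qed

text \<open>
  Weak duality: for a primal feasible \<open>x\<close>, the slack of the constraints is a nonnegative element of
  \<open>Q\<close>, so \<open>\<phi>\<close> is nonnegative at it. If no such \<open>x\<close> exists, the bound is \<open>\<infinity>\<close>.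
\<close>

lemma weak_duality:
  assumes "subspace Q" and sub: "constraint_space n a b \<subseteq> Q"
    and \<phi>: "\<phi> \<in> DSILP_feasible_set I n a c Q"
  shows "ereal (\<phi> b) \<le> OV I n a c b"
  unfolding OV_def
proof (rule INF_greatest)
  fix x assume x: "x \<in> primal_feasible_set I n a b"
  define s where "s = (\<Sum>k\<in>{1..n}. x k *\<^sub>R a k)"
  have b: "b \<in> Q" and a: "\<And>k. k \<in> {1..n} \<Longrightarrow> a k \<in> Q"
    using sub rhs_in_constraint_space column_in_constraint_space by blast+
  have lin: "\<phi> \<in> linear_functionals Q"
    using \<phi> by (simp add: DSILP_feasible_set_def positive_dual_def)
  have s: "s \<in> Q"
    unfolding s_def using assms(1) a by (intro subspace_sum subspace_scale)
  have slack: "s - b \<in> Q"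
    using assms(1) s b by (rule subspace_diff)
  have "s i = (\<Sum>k=1..n. a k i * x k)" for i
  proof -
    have "(\<Sum>k\<in>S. x k *\<^sub>R a k) i = (\<Sum>k\<in>S. a k i * x k)" if "finite S" for S
      using that by (induction S rule: finite_induct) (simp_all add: scaleR_fun_def mult.commute)
    then show ?thesis by (simp add: s_def)
  qed
  then have "\<forall>i\<in>I. (s - b) i \<ge> 0"
    using x by (simp add: primal_feasible_set_def)
  then have "\<phi> (s - b) \<ge> 0"
    using \<phi> slack by (simp add: DSILP_feasible_set_def positive_dual_def)
  moreover have "\<phi> ((s - b) + b) = \<phi> (s - b) + \<phi> b"
    using lin slack b unfolding linear_functionals_def by blast
  moreover have "\<phi> s = (\<Sum>k=1..n. c k * x k)"
    using linear_functionals_sum[OF assms(1) lin, of "{1..n}" a x] a \<phi>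
    by (simp add: s_def DSILP_feasible_set_def mult.commute)
  ultimately show "ereal (\<phi> b) \<le> ereal (\<Sum>k=1..n. c k * x k)"
    by simp
qed

lemma DSILP_feasible_restrict:
  assumes "\<psi> \<in> DSILP_feasible_set I n a c Y" "subspace Q" "Q \<subseteq> Y"
    and sub: "constraint_space n a b \<subseteq> Q"
  shows "restrict \<psi> Q \<in> DSILP_feasible_set I n a c Q"
proof -
  have "a k \<in> Q" if "k \<in> {1..n}" for k
    using sub that column_in_constraint_space by blast
  with assms show ?thesis
    by (auto simp: DSILP_feasible_set_def positive_dual_def linear_functionals_def
        subset_iff subspace_add subspace_scale)
qed

lemma SD_subspace:
  assumes "SD I n a c b Y" "subspace Q" "Q \<subseteq> Y" and sub: "constraint_space n a b \<subseteq> Q"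
  shows "SD I n a c b Q"
proof -
  obtain \<psi> where \<psi>: "\<psi> \<in> DSILP_feasible_set I n a c Y" "ereal (\<psi> b) = OV I n a c b"
    using assms(1) by (auto simp: SD_def)
  have "b \<in> Q"
    using sub rhs_in_constraint_space by blast
  then have "ereal (restrict \<psi> Q b) = OV I n a c b"
    using \<psi>(2) by simp
  then show ?thesis
    unfolding SD_def using DSILP_feasible_restrict[OF \<psi>(1) assms(2-4)] by blast
qed

lemma DP_subspace:
  assumes "DP I n a c b Y" "subspace Q" "Q \<subseteq> Y" and sub: "constraint_space n a b \<subseteq> Q"
  shows "DP I n a c b Q"
  unfolding DP_def
proof (intro ballI impI)
  fix d assume d: "d \<in> Q" and feas: "primal_feasible_set I n a (b + d) \<noteq> {}"
  obtain \<psi> \<epsilon>' where opt: "DSILP_optimal I n a c b Y \<psi>" and pos: "\<epsilon>' > 0"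
    and eq: "\<And>\<epsilon>. \<epsilon> \<in> {0..\<epsilon>'} \<Longrightarrow>
        OV I n a c (b + \<epsilon> *\<^sub>R d) = ereal (\<psi> (b + \<epsilon> *\<^sub>R d)) \<and>
        ereal (\<psi> (b + \<epsilon> *\<^sub>R d)) = OV I n a c b + ereal (\<epsilon> * \<psi> d)"
    using assms(1,3) d feas unfolding DP_def by blast
  have b: "b \<in> Q"
    using sub rhs_in_constraint_space by blast
  have feasible: "restrict \<psi> Q \<in> DSILP_feasible_set I n a c Q"
    using opt assms(2-4) by (auto simp: DSILP_optimal_def intro: DSILP_feasible_restrict)
  have attained: "OV I n a c b = ereal (\<psi> b)"
    using eq[THEN conjunct1, of 0] pos by simp
  have optimal: "DSILP_optimal I n a c b Q (restrict \<psi> Q)"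
    unfolding DSILP_optimal_def
  proof (intro conjI ballI)
    fix \<phi> assume "\<phi> \<in> DSILP_feasible_set I n a c Q"
    then have "ereal (\<phi> b) \<le> ereal (\<psi> b)"
      using weak_duality[OF assms(2) sub] attained by metis
    then show "\<phi> b \<le> restrict \<psi> Q b"
      using b by simp
  qed (rule feasible)
  have "b + \<epsilon> *\<^sub>R d \<in> Q" for \<epsilon>
    using assms(2) b d by (intro subspace_add subspace_scale)
  then have "restrict \<psi> Q (b + \<epsilon> *\<^sub>R d) = \<psi> (b + \<epsilon> *\<^sub>R d)" for \<epsilon>
    by simp
  moreover have "restrict \<psi> Q d = \<psi> d"
    using d by simp
  ultimately have "OV I n a c (b + \<epsilon> *\<^sub>R d) = ereal (restrict \<psi> Q (b + \<epsilon> *\<^sub>R d)) \<and>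
      ereal (restrict \<psi> Q (b + \<epsilon> *\<^sub>R d)) = OV I n a c b + ereal (\<epsilon> * restrict \<psi> Q d)"
    if "\<epsilon> \<in> {0..\<epsilon>'}" for \<epsilon>
    using eq[OF that] by metis
  with optimal pos show "\<exists>\<psi> \<epsilon>'. DSILP_optimal I n a c b Q \<psi> \<and> \<epsilon>' > 0 \<and>
      (\<forall>\<epsilon>\<in>{0..\<epsilon>'}.
         OV I n a c (b + \<epsilon> *\<^sub>R d) = ereal (\<psi> (b + \<epsilon> *\<^sub>R d)) \<and>
         ereal (\<psi> (b + \<epsilon> *\<^sub>R d)) = OV I n a c b + ereal (\<epsilon> * \<psi> d))"
    by blast
qed

theorem proposition5p2:
  fixes I :: "'i set" and n :: nat
    and a :: "nat \<Rightarrow> 'i \<Rightarrow> real" and b :: "'i \<Rightarrow> real" and c :: "nat \<Rightarrow> real"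
    and Y :: "('i \<Rightarrow> real) set"
  assumes "\<forall>k\<in>{1..n}. a k \<in> real_functions I" and "b \<in> real_functions I"
    and "subspace Y" and "Y \<subseteq> real_functions I" and "constraint_space n a b \<subseteq> Y"
  shows "(SD I n a c b Y \<longrightarrow>
            (\<forall>Q. subspace Q \<and> Q \<subseteq> Y \<and> constraint_space n a b \<subseteq> Q \<longrightarrow> SD I n a c b Q)) \<and>
         (DP I n a c b Y \<longrightarrow>
            (\<forall>Q. subspace Q \<and> Q \<subseteq> Y \<and> constraint_space n a b \<subseteq> Q \<longrightarrow> DP I n a c b Q))"
  using SD_subspace DP_subspace by blast

end
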